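(* Let $\mathsf{P}$ be a well labelled poset on $[n]$. Then $F(\mathsf{P})=F_\mathsf{P}(\mathbf{x})$, where $F(\mathsf{P})=F_0(C(\mathsf{P}))$ is the specialization at $q=0$ of the weighted quasisymmetric enumerator of the poset cone and $F_\mathsf{P}(\mathbf{x})$ is the enumerator of $\mathsf{P}$-partitions.
   Context: A poset $\mathsf{P}$ on $[n]=\{1,\ldots,n\}$ is well labelled if $i<_\mathsf{P}j$ implies $i>_\mathbb{Z}j$. For a well labelled poset a $\mathsf{P}$-partition is a function $f:\mathsf{P}\to\mathbb{N}=\{1,2,\ldots\}$ such that $i<_\mathsf{P}j$ implies $f(i)<f(j)$; $\mathcal{A}(\mathsf{P})$ is the set of all $\mathsf{P}$-partitions, and the enumerator of $\mathsf{P}$-partitions is $$F_\mathsf{P}(\mathbf{x})=\sum_{f\in\mathcal{A}(\mathsf{P})}x_{f(1)}x_{f(2)}\cdots x_{f(n)}.$$ The poset cone is $C(\mathsf{P})=\mathrm{cone}\{e_i-e_j:i<_\mathsf{P}j\}\subseteq\mathbb{R}^n$, with $e_1,\ldots,e_n$ the standard basis. For a nonempty face $G$ of $C(\mathsf{P})$ (including $C(\mathsf{P})$ itself), $C_G^\circ$ is the relative interior of the normal cone at $G$, i.e. the set of $\omega\in\mathbb{R}^n$ such that $x\mapsto\langle\omega,x\rangle$ attains a maximum on $C(\mathsf{P})$ with set of maximizers exactly $G$. The weighted enumerator is $$F_q(C(\mathsf{P}))=\sum_{G}q^{\dim G}\sum_{\omega\in\mathbb{Z}^n_+\cap C_G^\circ}x_{\omega_1}\cdots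 x_{\omega_n},$$ the sum being over nonempty faces $G$ and $\mathbb{Z}^n_+$ denoting vectors of positive integers; $F(\mathsf{P})=F_0(C(\mathsf{P}))$ is its value at $q=0$ (with $0^0=1$). Equivalently, $F(\mathsf{P})=\sum_\mathcal{F}M_\mathcal{F}$, over all flags $\mathcal{F}:\emptyset=F_0\subset F_1\subset\cdots\subset F_k=[n]$ (strict inclusions) such that every $F_i$ is an ideal of $\mathsf{P}$ (no element outside $F_i$ is less than an element of $F_i$) and every restriction $\mathsf{P}|_{F_i\setminus F_{i-1}}$ has no relations between distinct elements. Here $M_\mathcal{F}=M_\alpha=\sum_{i_1<\cdots<i_k}x_{i_1}^{\alpha_1}\cdots x_{i_k}^{\alpha_k}$ with $\alpha_j=|F_j\setminus F_{j-1}|$. *)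

theory Defs
  imports
    "HOL-Analysis.Analysis"
    "HOL-Computational_Algebra.Polynomial"
    "HOL-Library.Poly_Mapping"
begin

text \<open>
  The label set \<open>[n] = {1, \<dots>, n}\<close> is rendered as a finite linearly ordered index type \<open>'n\<close>
  with \<open>n = CARD('n)\<close>; the order of \<open>'n\<close> plays the role of the order of the integer labels,
  and \<open>real ^ 'n\<close> is \<open>\<real>\<^sup>n\<close>. A poset on \<open>[n]\<close> is a reflexive relation \<open>P\<close> with
  \<open>partial_order_on UNIV P\<close>.
\<close>

definition poset_less :: "'n rel \<Rightarrow> 'n \<Rightarrow> 'n \<Rightarrow> bool" where
  "poset_less P i j \<longleftrightarrow> (i, j) \<in> P \<and> i \<noteq> j"

definition well_labelled :: "'n::linorder rel \<Rightarrow> bool" where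
  "well_labelled P \<longleftrightarrow> (\<forall>i j. poset_less P i j \<longrightarrow> i > j)"

text \<open>
  Formal power series in \<open>x\<^sub>1, x\<^sub>2, \<dots>\<close> are given by their coefficients: a monomial is its finitely
  supported exponent vector, and two series are equal iff all their coefficients are.
\<close>

type_synonym 'a power_series = "(nat \<Rightarrow>\<^sub>0 nat) \<Rightarrow> 'a"

text \<open>The exponent vector of the monomial \<open>\<Prod>i. x (f i)\<close>.\<close>

definition monomial_of :: "('n::finite \<Rightarrow> nat) \<Rightarrow> (nat \<Rightarrow>\<^sub>0 nat)" where
  "monomial_of f = (\<Sum>i\<in>UNIV. Poly_Mapping.single (f i) 1)"

text \<open>
  The formal infinite sum of the monomials of all \<open>f \<in> A\<close>; every monomial arises from only finitely
  many \<open>f\<close>, as shown next, so the cardinality below is the true number of summands.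
\<close>

definition series_of :: "('n::finite \<Rightarrow> nat) set \<Rightarrow> 'a::comm_semiring_1 power_series" where
  "series_of A = (\<lambda>m. of_nat (card {f \<in> A. monomial_of f = m}))"

lemma finite_monomial_fibre: "finite {f \<in> A. monomial_of (f :: 'n::finite \<Rightarrow> nat) = m}"
proof (rule finite_subset)
  have "f i \<in> Poly_Mapping.keys m" if "monomial_of f = m" for f :: "'n \<Rightarrow> nat" and i
  proof -
    have "Poly_Mapping.lookup m (f i) = (\<Sum>j\<in>UNIV. Poly_Mapping.lookup (Poly_Mapping.single (f j) 1) (f i))"
      unfolding that[symmetric] monomial_of_def by (rule Poly_Mapping.lookup_sum)
    also have "\<dots> \<ge> Poly_Mapping.lookup (Poly_Mapping.single (f i) (1::nat)) (f i)"
      by (rule member_le_sum) auto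
    finally have "Poly_Mapping.lookup m (f i) \<noteq> 0"
      by simp
    then show ?thesis
      by (simp add: in_keys_iff)
  qed
  then show "{f \<in> A. monomial_of f = m} \<subseteq> PiE UNIV (\<lambda>_. Poly_Mapping.keys m)"
    by blast
  show "finite (PiE (UNIV :: 'n set) (\<lambda>_. Poly_Mapping.keys m))"
    by (rule finite_PiE) auto
qed

definition P_partitions :: "'n rel \<Rightarrow> ('n \<Rightarrow> nat) set" where
  "P_partitions P = {f. (\<forall>i. f i \<ge> 1) \<and> (\<forall>i j. poset_less P i j \<longrightarrow> f i < f j)}"

definition P_partition_enumerator :: "'n::finite rel \<Rightarrow> int power_series" where
  "P_partition_enumerator P = series_of (P_partitions P)"

definition poset_cone :: "'n::finite rel \<Rightarrow> (real ^ 'n) set" where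
  "poset_cone P = convex_cone hull {axis i 1 - axis j 1 | i j. poset_less P i j}"

text \<open>Relative interior of the normal cone of \<open>C\<close> at a nonempty face \<open>G\<close>.\<close>

definition open_normal_cone :: "'a::euclidean_space set \<Rightarrow> 'a set \<Rightarrow> 'a set" where
  "open_normal_cone C G = {\<omega>. G = {x \<in> C. \<forall>y\<in>C. \<omega> \<bullet> y \<le> \<omega> \<bullet> x}}"

definition positive_lattice_points :: "(real ^ 'n) set \<Rightarrow> ('n::finite \<Rightarrow> nat) set" where
  "positive_lattice_points S = {\<omega>. (\<forall>i. \<omega> i \<ge> 1) \<and> (\<chi> i. real (\<omega> i)) \<in> S}"

text \<open>
  Coefficients are polynomials in \<open>q\<close>. Nonempty faces have \<open>aff_dim G \<ge> 0\<close>, so \<open>nat\<close> truncates nothing.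
\<close>

definition weighted_enumerator :: "(real ^ 'n::finite) set \<Rightarrow> int poly power_series" where
  "weighted_enumerator C = (\<lambda>m. \<Sum>G | G face_of C \<and> G \<noteq> {}.
     Polynomial.monom 1 (nat (aff_dim G)) * series_of (positive_lattice_points (open_normal_cone C G)) m)"

lemma finite_faces_poset_cone: "finite {G. G face_of poset_cone P \<and> G \<noteq> {}}"
proof -
  have "{axis i 1 - axis j 1 | i j. poset_less P i j}
      \<subseteq> (\<lambda>(i, j). axis i 1 - axis j 1 :: real ^ 'a) ` UNIV"
    by auto
  then have "finite {axis i 1 - axis j 1 :: real ^ 'a | i j. poset_less P i j}"
    by (rule finite_subset) simp
  then have "polyhedron (poset_cone P)"
    unfolding poset_cone_def by (rule polyhedron_convex_cone_hull)
  then have "finite {G. G face_of poset_cone P}"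
    by (rule finite_polyhedron_faces)
  then show ?thesis
    by (rule rev_finite_subset) blast
qed

definition specialize_q :: "'a::comm_semiring_1 \<Rightarrow> 'a poly power_series \<Rightarrow> 'a power_series" where
  "specialize_q c F = (\<lambda>m. poly (F m) c)"

definition poset_enumerator :: "'n::finite rel \<Rightarrow> int power_series" where
  "poset_enumerator P = specialize_q 0 (weighted_enumerator (poset_cone P))"

end

theory Submission
  imports Defs
begin

text \<open>
  At \<open>q = 0\<close> only zero-dimensional faces survive, and the only such face of a cone is its apex.
  A linear functional is maximised over the cone exactly at the apex iff it is negative on
  every generator, and for the generators \<open>e\<^sub>i - e\<^sub>j\<close> this says \<open>\<omega>\<^sub>i < \<omega>\<^sub>j\<close>.
\<close>

text \<open>If \<open>0\<close> is a maximizer, the maximum is 0, so a generator on which \<omega>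
  is not negative would be a second, nonzero maximizer. Conversely, negativity on the generators
  spreads to every nonzero point of the cone.\<close>

lemma open_normal_cone_convex_cone_hull_zero:
  assumes "0 \<notin> S"
  shows "open_normal_cone (convex_cone hull S) {0} = {\<omega>. \<forall>v\<in>S. \<omega> \<bullet> v < 0}"
proof (intro set_eqI iffI)
  fix \<omega> assume "\<omega> \<in> open_normal_cone (convex_cone hull S) {0}"
  then have eq: "{0} = {x \<in> convex_cone hull S. \<forall>y\<in>convex_cone hull S. \<omega> \<bullet> y \<le> \<omega> \<bullet> x}"
    unfolding open_normal_cone_def by simp
  have nonpos: "\<omega> \<bullet> y \<le> 0" if "y \<in> convex_cone hull S" for y
    using that eqset_imp_iff[OF eq, of 0] by auto
  have "\<omega> \<bullet> v < 0" if "v \<in> S" for v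
  proof (rule ccontr)
    have v: "v \<in> convex_cone hull S"
      using that by (rule hull_inc)
    assume "\<not> \<omega> \<bullet> v < 0"
    with v nonpos have "v \<in> {x \<in> convex_cone hull S. \<forall>y\<in>convex_cone hull S. \<omega> \<bullet> y \<le> \<omega> \<bullet> x}"
      by force
    with eq have "v = 0" by blast
    with that assms show False by simp
  qed
  then show "\<omega> \<in> {\<omega>. \<forall>v\<in>S. \<omega> \<bullet> v < 0}" by simp
next
  fix \<omega> assume "\<omega> \<in> {\<omega>. \<forall>v\<in>S. \<omega> \<bullet> v < 0}"
  then have neg: "\<omega> \<bullet> v < 0" if "v \<in> S" for v
    using that by simp
  \<comment> \<open>An open half-space becomes a convex cone once the apex is added, so minimality
    of the hull applies while the inequality stays strict away from \<open>0\<close>.\<close>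
  have "convex_cone (insert 0 {x. \<omega> \<bullet> x < 0})"
    unfolding convex_cone_iff by (auto simp: inner_add_right mult_less_0_iff)
  then have sub: "convex_cone hull S \<subseteq> insert 0 {x. \<omega> \<bullet> x < 0}"
    using neg by (intro hull_minimal) auto
  have zero: "0 \<in> convex_cone hull S"
    by (rule convex_cone_hull_contains_0)
  have "{x \<in> convex_cone hull S. \<forall>y\<in>convex_cone hull S. \<omega> \<bullet> y \<le> \<omega> \<bullet> x} = {0}"
    using sub zero by force
  then show "\<omega> \<in> open_normal_cone (convex_cone hull S) {0}"
    unfolding open_normal_cone_def by simp
qed

text \<open>Since \<open>0\<close> is a maximizer, the maximum of \<omega> on \<open>C\<close> is 0,
  and \<open>G\<close> is cut out by the supporting hyperplane through the origin. In contrapositive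
  form: if \<open>{0}\<close> is not a face, its open normal cone is empty.\<close>

lemma face_of_open_normal_cone:
  assumes "convex C" and "0 \<in> G" and "\<omega> \<in> open_normal_cone C G"
  shows "G face_of C"
proof -
  have G: "G = {x \<in> C. \<forall>y\<in>C. \<omega> \<bullet> y \<le> \<omega> \<bullet> x}"
    using assms(3) unfolding open_normal_cone_def by simp
  with assms(2) have zero: "0 \<in> C" "\<And>y. y \<in> C \<Longrightarrow> \<omega> \<bullet> y \<le> 0"
    by auto
  have "\<omega> \<bullet> x = 0" if "x \<in> G" for x
  proof (rule antisym)
    have x: "x \<in> C" "\<forall>y\<in>C. \<omega> \<bullet> y \<le> \<omega> \<bullet> x"
      using that eqset_imp_iff[OF G, of x] by auto
    show "\<omega> \<bullet> x \<le> 0" by (rule zero(2)) (rule x(1))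
    show "0 \<le> \<omega> \<bullet> x" using bspec[OF x(2) zero(1)] by simp
  qed
  then have "G = C \<inter> {x. \<omega> \<bullet> x = 0}"
    using G zero(2) by auto
  then show ?thesis
    using face_of_Int_supporting_hyperplane_le[OF assms(1) zero(2)] by simp
qed

text \<open>A nonzero \<open>x\<close> is the midpoint of \<open>0\<close> and
  \<open>2 *\<^sub>R x\<close>, both in \<open>C\<close>, so a face containing \<open>x\<close> must
  contain \<open>0\<close> as well and cannot be a singleton \<open>{x}\<close>.\<close>

lemma zero_dimensional_face_of_convex_cone:
  assumes "convex_cone C" and "G face_of C" and "aff_dim G = 0"
  shows "G = {0}"
proof -
  obtain x where G: "G = {x}"
    using assms(3) aff_dim_eq_0 by blast
  have "x \<in> C"
    using assms(2) G face_of_imp_subset by blast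
  then have C: "0 \<in> C" "2 *\<^sub>R x \<in> C"
    using assms(1) by (auto simp: convex_cone_contains_0 convex_cone_scaleR)
  have "x = 0"
  proof (rule ccontr)
    assume "x \<noteq> 0"
    then have "x \<in> open_segment 0 (2 *\<^sub>R x)"
      by (auto simp: in_segment intro!: exI[of _ "1/2"])
    then have "0 \<in> G"
      using assms(2) C G by (auto simp: face_of_def)
    with G \<open>x \<noteq> 0\<close> show False by simp
  qed
  with G show ?thesis by simp
qed

lemma specialize_q_0_weighted_enumerator:
  assumes "convex_cone C" and "finite {G. G face_of C \<and> G \<noteq> {}}"
  shows "specialize_q 0 (weighted_enumerator C) =
    series_of (positive_lattice_points (open_normal_cone C {0}))"
proof
  fix m
  let ?c = "\<lambda>G. series_of (positive_lattice_points (open_normal_cone C G)) m :: int"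
  have "specialize_q 0 (weighted_enumerator C) m =
      (\<Sum>G | G face_of C \<and> G \<noteq> {}. 0 ^ nat (aff_dim G) * ?c G)"
    by (simp add: specialize_q_def weighted_enumerator_def poly_sum poly_monom series_of_def)
  also have "\<dots> = (\<Sum>G | G face_of C \<and> G = {0}. ?c G)"
  proof (rule sum.mono_neutral_cong_right[OF assms(2)])
    \<comment> \<open>Only the empty set has dimension -1 and only \<open>{0}\<close> can have
      dimension 0, so every other face carries a positive power of 0.\<close>
    have "aff_dim G > 0" if "G face_of C" "G \<noteq> {}" "G \<noteq> {0}" for G
      using zero_dimensional_face_of_convex_cone[OF assms(1) that(1)] that aff_dim_geq[of G]
        aff_dim_empty[of G] by linarith
    then show "\<forall>G\<in>{G. G face_of C \<and> G \<noteq> {}} - {G. G face_of C \<and> G = {0}}.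
        0 ^ nat (aff_dim G) * ?c G = 0"
      by auto
  qed auto
  also have "\<dots> = ?c {0}"
  \<comment> \<open>\<open>{0}\<close> fails to be a face when \<open>C\<close> contains a line. The
    sum is then empty, and the right-hand side vanishes too because no \<omega> is maximized exactly
    at \<open>0\<close>.\<close>
  proof (cases "{0} face_of C")
    case True
    then have "{G. G face_of C \<and> G = {0}} = {{0}}" by auto
    then show ?thesis by simp
  next
    case False
    then have "open_normal_cone C {0} = {}"
      using face_of_open_normal_cone[of C "{0}"] assms(1) by (auto simp: convex_cone_def)
    then have "?c {0} = 0"
      by (simp add: series_of_def positive_lattice_points_def)
    moreover have "{G. G face_of C \<and> G = {0}} = {}"
      using False by auto
    ultimately show ?thesis by (simp only: sum.empty)
  qed
  finally show "specialize_q 0 (weighted_enumerator C) m = ?c {0}" .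
qed

lemma positive_lattice_points_apex_poset_cone:
  fixes P :: "'n::finite rel"
  shows "positive_lattice_points (open_normal_cone (poset_cone P) {0}) = P_partitions P"
proof -
  \<comment> \<open>\<open>poset_less\<close> is strict, so the two basis vectors in each generator
    differ.\<close>
  have "0 \<notin> {axis i 1 - axis j 1 :: real ^ 'n | i j. poset_less P i j}"
    by (auto simp: poset_less_def axis_eq_axis)
  note cone = open_normal_cone_convex_cone_hull_zero[OF this, folded poset_cone_def]
  have "(\<chi> i. real (f i)) \<in> open_normal_cone (poset_cone P) {0} \<longleftrightarrow>
      (\<forall>i j. poset_less P i j \<longrightarrow> f i < f j)" for f :: "'n \<Rightarrow> nat"
    unfolding cone by (fastforce simp: inner_diff_right inner_axis)
  then show ?thesis
    by (simp add: positive_lattice_points_def P_partitions_def)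
qed

theorem theorem5p8:
  fixes P :: "'n::{finite,linorder} rel"
  assumes "partial_order_on UNIV P" and "well_labelled P"
  shows "poset_enumerator P = P_partition_enumerator P"
proof -
  have "convex_cone (poset_cone P)"
    unfolding poset_cone_def by (rule convex_cone_convex_cone_hull)
  \<comment> \<open>Both enumerators become \<open>series_of\<close> one and the same set of
    functions, so no comparison of coefficients remains.\<close>
  from specialize_q_0_weighted_enumerator[OF this finite_faces_poset_cone]
  show ?thesis
    unfolding poset_enumerator_def P_partition_enumerator_def
    by (simp only: positive_lattice_points_apex_poset_cone)
qed

end
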